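(* Consider sequences generated by the iTRDH algorithm described in the context. Assume that there is $d_{\max}>0$ with $\|d_k\|_\infty\le d_{\max}$ for all $k\in\mathbb{N}$, and that there exist $\kappa_{\mathrm{m}}>0$ and $\kappa_{\mathrm{mdc}}\in(0,1)$ such that for all $k$, $$|f(x_k+s_k)+h(x_k+s_k)-m(s_k;x_k,D_k)|\le\kappa_{\mathrm{m}}\|s_k\|^2,\qquad \xi(\Delta_k;x_k,D_k)\ge\kappa_{\mathrm{mdc}}\,\xi_{\mathrm{cp}}(\Delta_k;x_k,\nu_k).$$ Assume that the algorithm generates infinitely many successful iterations (iterations with $\rho_k\ge\eta_1$) and that there exists $(f+h)_{\mathrm{low}}\in\mathbb{R}$ such that $(f+h)(x_k)\ge(f+h)_{\mathrm{low}}$ for all $k\in\mathbb{N}$. For $\epsilon\in(0,1)$, let $U(\epsilon)$ be the set of unsuccessful iterations performed until the criticality measure drops to $\epsilon$ or below, i.e., $$U(\epsilon):=\{k\in\mathbb{N}\ :\ \rho_k<\eta_1\ \text{and}\ \nu_i^{-1/2}\xi(\Delta_i;x_i,D_i)^{1/2}>\epsilon\ \text{for all } 0\le i\le k\}.$$ Then $|U(\epsilon)|=O(\epsilon^{-2})$, i.e., there exists a constant $C>0$ such that $|U(\epsilon)|\le C\epsilon^{-2}$ for all sufficiently small $\epsilon>0$.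
   Context: Problem: minimize $f(x)+h(x)$ subject to $\ell\le x\le u$, where $\ell\in(\mathbb{R}\cup\{-\infty\})^n$, $u\in(\mathbb{R}\cup\{+\infty\})^n$, $\ell\le u$ componentwise, $f:\mathbb{R}^n\to\mathbb{R}$ is continuously differentiable on an open set containing $[\ell,u]$, and $h:\mathbb{R}^n\to\mathbb{R}\cup\{+\infty\}$ is proper and lower semicontinuous. $\chi(\cdot\mid A)$ is the indicator of $A$ ($0$ on $A$, $+\infty$ elsewhere). $\|\cdot\|$ is the norm defining the trust region, and $\mathbb{B}$ is its closed unit ball. $|U|$ denotes the cardinality of a set $U$. For $x$ with $h(x)$ finite, $\psi(\cdot;x)$ is a model of $s\mapsto h(x+s)$ that is proper, lower semicontinuous, with $\psi(0;x)=h(x)$ and $\partial\psi(0;x)=\partial h(x)$ ($\partial$ is the limiting subdifferential). For $\nu>0$ and $D$ diagonal, $\varphi_{\mathrm{cp}}(s;x):=f(x)+\nabla f(x)^Ts$, $m(s;x,\nu):=\varphi_{\mathrm{cp}}(s;x)+\tfrac12\nu^{-1}\|s\|_2^2+\psi(s;x)$, and $m(s;x,D):=\varphi_{\mathrm{cp}}(s;x)+\tfrac12s^TDs+\psi(s;x)$. iTRDH algorithm. Constants: $0<\eta_1\le\eta_2<1$, $0<1/\gamma_3\le\gamma_1\le\gamma_2<1<\gamma_3\le\gamma_4$, $\alpha>0$. Start from $x_0\in[\ell,u]$ with $h(x_0)$ finite, $\Delta_0>0$ and $d_0\in\mathbb{R}^n$. For $k=0,1,\dots$: set $D_k=\operatorname{diag}(d_k)$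 and $\nu_k:=1/(\|d_k\|_\infty+\alpha^{-1})$; compute $s_k\in\operatorname{argmin}_s\ m(s;x_k,D_k)+\chi(x_k+s\mid[\ell,u]\cap(x_k+\Delta_k\mathbb{B}))$; compute $$\rho_k:=\frac{f(x_k)+h(x_k)-(f(x_k+s_k)+h(x_k+s_k))}{m(0;x_k,D_k)-m(s_k;x_k,D_k)};$$ set $x_{k+1}=x_k+s_k$ if $\rho_k\ge\eta_1$ and $x_{k+1}=x_k$ otherwise; choose an arbitrary $d_{k+1}\in\mathbb{R}^n$; choose $\Delta_{k+1}\in[\gamma_3\Delta_k,\gamma_4\Delta_k]$ if $\rho_k\ge\eta_2$ (very successful), $\Delta_{k+1}\in[\gamma_2\Delta_k,\Delta_k]$ if $\eta_1\le\rho_k<\eta_2$ (successful), $\Delta_{k+1}\in[\gamma_1\Delta_k,\gamma_2\Delta_k]$ if $\rho_k<\eta_1$ (unsuccessful). Model decreases: $\xi(\Delta_k;x_k,D_k):=f(x_k)+h(x_k)-m(s_k;x_k,D_k)$, and $\xi_{\mathrm{cp}}(\Delta_k;x_k,\nu_k):=f(x_k)+h(x_k)-(\varphi_{\mathrm{cp}}(s_{k,1};x_k)+\psi(s_{k,1};x_k))$, where $s_{k,1}\in\operatorname{argmin}_s\ m(s;x_k,\nu_k)+\chi(x_k+s\mid[\ell,u]\cap(x_k+\Delta_k\mathbb{B}))$ (used only in the analysis). It is understood that $\xi(\Delta_k;x_k,D_k)>0$ at every iteration, so that $\rho_k$ is well defined. *)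

theory Defs
  imports "HOL-Analysis.Analysis"
begin

definition proper_fun :: "('a \<Rightarrow> ereal) \<Rightarrow> bool" where
  "proper_fun \<phi> \<longleftrightarrow> (\<forall>x. \<phi> x \<noteq> -\<infinity>) \<and> (\<exists>x. \<phi> x \<noteq> \<infinity>)"

text \<open>The filter \<^term>\<open>at x\<close> omits \<^term>\<open>x\<close> itself, which does not affect lower semicontinuity.\<close>

definition lsc_fun :: "('a::topological_space \<Rightarrow> ereal) \<Rightarrow> bool" where
  "lsc_fun \<phi> \<longleftrightarrow> (\<forall>x. \<phi> x \<le> Liminf (at x) \<phi>)"

text \<open>
  The regular (Frechet) subdifferential, empty where \<open>\<phi>\<close> is not finite, and the limiting
  subdifferential of Mordukhovich, in the sense of Rockafellar and Wets:
  \<open>v\<close> is a regular subgradient iff \<open>\<phi> y \<ge> \<phi> x + v \<bullet> (y - x) + o(norm (y - x))\<close>.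
\<close>

definition regular_subdiff :: "('a::euclidean_space \<Rightarrow> ereal) \<Rightarrow> 'a \<Rightarrow> 'a set" where
  "regular_subdiff \<phi> x =
     {v. \<bar>\<phi> x\<bar> \<noteq> \<infinity> \<and>
         0 \<le> Liminf (at x) (\<lambda>y. (\<phi> y - \<phi> x - ereal (v \<bullet> (y - x))) / ereal (norm (y - x)))}"

definition limiting_subdiff :: "('a::euclidean_space \<Rightarrow> ereal) \<Rightarrow> 'a \<Rightarrow> 'a set" where
  "limiting_subdiff \<phi> x =
     {v. \<bar>\<phi> x\<bar> \<noteq> \<infinity> \<and>
         (\<exists>X V. X \<longlonglongrightarrow> x \<and> (\<lambda>j. \<phi> (X j)) \<longlonglongrightarrow> \<phi> x \<and>
                (\<forall>j. V j \<in> regular_subdiff \<phi> (X j)) \<and> V \<longlonglongrightarrow> v)}"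

definition gradient :: "('a::euclidean_space \<Rightarrow> real) \<Rightarrow> 'a \<Rightarrow> 'a" where
  "gradient f x = (THE g. GDERIV f x :> g)"

definition C1_on :: "('a::euclidean_space \<Rightarrow> real) \<Rightarrow> 'a set \<Rightarrow> bool" where
  "C1_on f S \<longleftrightarrow> (\<forall>x\<in>S. \<exists>g. GDERIV f x :> g) \<and> continuous_on S (gradient f)"

definition chi :: "'a set \<Rightarrow> 'a \<Rightarrow> ereal" where
  "chi A x = (if x \<in> A then 0 else \<infinity>)"

definition box_set :: "ereal ^ 'n \<Rightarrow> ereal ^ 'n \<Rightarrow> (real ^ 'n) set" where
  "box_set l u = {x. \<forall>i. l $ i \<le> ereal (x $ i) \<and> ereal (x $ i) \<le> u $ i}"

definition is_norm :: "('a::real_vector \<Rightarrow> real) \<Rightarrow> bool" where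
  "is_norm N \<longleftrightarrow> (\<forall>x. N x = 0 \<longleftrightarrow> x = 0) \<and> (\<forall>a x. N (a *\<^sub>R x) = \<bar>a\<bar> * N x) \<and>
                (\<forall>x y. N (x + y) \<le> N x + N y)"

definition trust_region :: "('a::real_vector \<Rightarrow> real) \<Rightarrow> 'a \<Rightarrow> real \<Rightarrow> 'a set" where
  "trust_region N x \<Delta> = (\<lambda>b. x + \<Delta> *\<^sub>R b) ` {b. N b \<le> 1}"

text \<open>Throughout, \<open>\<psi> x s\<close> stands for \<open>\<psi>(s; x)\<close>, the model of \<open>h (x + s)\<close> about \<open>x\<close>;
  likewise the base point precedes the step in the models below.\<close>

definition is_model :: "((real ^ 'n) \<Rightarrow> ereal) \<Rightarrow> ((real ^ 'n) \<Rightarrow> (real ^ 'n) \<Rightarrow> ereal) \<Rightarrow> bool" where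
  "is_model h \<psi> \<longleftrightarrow>
     (\<forall>x. \<bar>h x\<bar> \<noteq> \<infinity> \<longrightarrow>
        proper_fun (\<psi> x) \<and> lsc_fun (\<psi> x) \<and> \<psi> x 0 = h x \<and>
        limiting_subdiff (\<psi> x) 0 = limiting_subdiff h x)"

definition diag :: "real ^ 'n \<Rightarrow> real ^ 'n ^ 'n" where
  "diag d = (\<chi> i j. if i = j then d $ i else 0)"

definition phi_cp :: "((real ^ 'n) \<Rightarrow> real) \<Rightarrow> real ^ 'n \<Rightarrow> real ^ 'n \<Rightarrow> real" where
  "phi_cp f x s = f x + gradient f x \<bullet> s"

definition m_nu :: "((real ^ 'n) \<Rightarrow> real) \<Rightarrow> ((real ^ 'n) \<Rightarrow> (real ^ 'n) \<Rightarrow> ereal) \<Rightarrow>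
    real ^ 'n \<Rightarrow> real \<Rightarrow> real ^ 'n \<Rightarrow> ereal" where
  "m_nu f \<psi> x \<nu> s = ereal (phi_cp f x s + 1/2 * inverse \<nu> * (norm s)\<^sup>2) + \<psi> x s"

definition m_D :: "((real ^ 'n) \<Rightarrow> real) \<Rightarrow> ((real ^ 'n) \<Rightarrow> (real ^ 'n) \<Rightarrow> ereal) \<Rightarrow>
    real ^ 'n \<Rightarrow> real ^ 'n ^ 'n \<Rightarrow> real ^ 'n \<Rightarrow> ereal" where
  "m_D f \<psi> x D s = ereal (phi_cp f x s + 1/2 * (s \<bullet> (D *v s))) + \<psi> x s"

definition step_size :: "real \<Rightarrow> real ^ 'n \<Rightarrow> real" where
  "step_size \<alpha> d = 1 / (infnorm d + inverse \<alpha>)"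

definition objective :: "((real ^ 'n) \<Rightarrow> real) \<Rightarrow> ((real ^ 'n) \<Rightarrow> ereal) \<Rightarrow> real ^ 'n \<Rightarrow> ereal" where
  "objective f h x = ereal (f x) + h x"

text \<open>
  The step minimises a model over \<open>{s. x + s \<in> [l, u] \<inter> (x + \<Delta> B)}\<close>; the constraint enters through
  the indicator function.
\<close>

definition is_tr_step :: "ereal ^ 'n \<Rightarrow> ereal ^ 'n \<Rightarrow> ((real ^ 'n) \<Rightarrow> real) \<Rightarrow>
    real ^ 'n \<Rightarrow> real \<Rightarrow> ((real ^ 'n) \<Rightarrow> ereal) \<Rightarrow> real ^ 'n \<Rightarrow> bool" where
  "is_tr_step l u N x \<Delta> m s \<longleftrightarrow>
     is_arg_min (\<lambda>s. m s + chi (box_set l u \<inter> trust_region N x \<Delta>) (x + s)) (\<lambda>_. True) s"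

text \<open>
  Model decreases, with the computed step as the last argument. In \<open>xi\<close> it is a minimiser of
  \<open>m_D f \<psi> x D\<close> over the trust region, in \<open>xi_cp\<close> it is a minimiser of \<open>m_nu f \<psi> x \<nu>\<close>, so that the radius
  and \<open>\<nu>\<close> enter through the step only.
\<close>

definition xi :: "((real ^ 'n) \<Rightarrow> real) \<Rightarrow> ((real ^ 'n) \<Rightarrow> ereal) \<Rightarrow>
    ((real ^ 'n) \<Rightarrow> (real ^ 'n) \<Rightarrow> ereal) \<Rightarrow> real ^ 'n \<Rightarrow> real ^ 'n ^ 'n \<Rightarrow> real ^ 'n \<Rightarrow> ereal" where
  "xi f h \<psi> x D s = objective f h x - m_D f \<psi> x D s"

definition xi_cp :: "((real ^ 'n) \<Rightarrow> real) \<Rightarrow> ((real ^ 'n) \<Rightarrow> ereal) \<Rightarrow>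
    ((real ^ 'n) \<Rightarrow> (real ^ 'n) \<Rightarrow> ereal) \<Rightarrow> real ^ 'n \<Rightarrow> real ^ 'n \<Rightarrow> ereal" where
  "xi_cp f h \<psi> x s = objective f h x - (ereal (phi_cp f x s) + \<psi> x s)"

definition rho :: "((real ^ 'n) \<Rightarrow> real) \<Rightarrow> ((real ^ 'n) \<Rightarrow> ereal) \<Rightarrow>
    ((real ^ 'n) \<Rightarrow> (real ^ 'n) \<Rightarrow> ereal) \<Rightarrow> real ^ 'n \<Rightarrow> real ^ 'n ^ 'n \<Rightarrow> real ^ 'n \<Rightarrow> ereal" where
  "rho f h \<psi> x D s =
     (objective f h x - objective f h (x + s)) / (m_D f \<psi> x D 0 - m_D f \<psi> x D s)"

text \<open>The diagonals \<open>d k\<close> are arbitrary and hence unconstrained here.\<close>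

definition iTRDH_run :: "ereal ^ 'n \<Rightarrow> ereal ^ 'n \<Rightarrow> ((real ^ 'n) \<Rightarrow> real) \<Rightarrow>
    ((real ^ 'n) \<Rightarrow> real) \<Rightarrow> ((real ^ 'n) \<Rightarrow> ereal) \<Rightarrow> ((real ^ 'n) \<Rightarrow> (real ^ 'n) \<Rightarrow> ereal) \<Rightarrow>
    real \<Rightarrow> real \<Rightarrow> real \<Rightarrow> real \<Rightarrow> real \<Rightarrow> real \<Rightarrow>
    (nat \<Rightarrow> real ^ 'n) \<Rightarrow> (nat \<Rightarrow> real ^ 'n) \<Rightarrow> (nat \<Rightarrow> real ^ 'n) \<Rightarrow> (nat \<Rightarrow> real) \<Rightarrow> bool" where
  "iTRDH_run l u N f h \<psi> \<eta>\<^sub>1 \<eta>\<^sub>2 \<gamma>\<^sub>1 \<gamma>\<^sub>2 \<gamma>\<^sub>3 \<gamma>\<^sub>4 x s d \<Delta> \<longleftrightarrow>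
     x 0 \<in> box_set l u \<and> \<bar>h (x 0)\<bar> \<noteq> \<infinity> \<and> 0 < \<Delta> 0 \<and>
     (\<forall>k. is_tr_step l u N (x k) (\<Delta> k) (m_D f \<psi> (x k) (diag (d k))) (s k) \<and>
       (let \<rho> = rho f h \<psi> (x k) (diag (d k)) (s k) in
          x (Suc k) = (if ereal \<eta>\<^sub>1 \<le> \<rho> then x k + s k else x k) \<and>
          (ereal \<eta>\<^sub>2 \<le> \<rho> \<longrightarrow> \<Delta> (Suc k) \<in> {\<gamma>\<^sub>3 * \<Delta> k .. \<gamma>\<^sub>4 * \<Delta> k}) \<and>
          (ereal \<eta>\<^sub>1 \<le> \<rho> \<and> \<rho> < ereal \<eta>\<^sub>2 \<longrightarrow> \<Delta> (Suc k) \<in> {\<gamma>\<^sub>2 * \<Delta> k .. \<Delta> k}) \<and>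
          (\<rho> < ereal \<eta>\<^sub>1 \<longrightarrow> \<Delta> (Suc k) \<in> {\<gamma>\<^sub>1 * \<Delta> k .. \<gamma>\<^sub>2 * \<Delta> k})))"

text \<open>
  The conversion with \<^const>\<open>real_of_ereal\<close> loses nothing along a run, since there
  \<open>xi\<close> is finite: \<open>0\<close> is a feasible step and \<open>\<psi> x\<close> is proper.
\<close>

definition crit_measure :: "real \<Rightarrow> ((real ^ 'n) \<Rightarrow> real) \<Rightarrow> ((real ^ 'n) \<Rightarrow> ereal) \<Rightarrow>
    ((real ^ 'n) \<Rightarrow> (real ^ 'n) \<Rightarrow> ereal) \<Rightarrow> real ^ 'n \<Rightarrow> real ^ 'n \<Rightarrow> real ^ 'n \<Rightarrow> real" where
  "crit_measure \<alpha> f h \<psi> x d s =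
     step_size \<alpha> d powr (-1/2) * real_of_ereal (xi f h \<psi> x (diag d) s) powr (1/2)"

definition unsuccessful_until :: "real \<Rightarrow> ((real ^ 'n) \<Rightarrow> real) \<Rightarrow> ((real ^ 'n) \<Rightarrow> ereal) \<Rightarrow>
    ((real ^ 'n) \<Rightarrow> (real ^ 'n) \<Rightarrow> ereal) \<Rightarrow> real \<Rightarrow>
    (nat \<Rightarrow> real ^ 'n) \<Rightarrow> (nat \<Rightarrow> real ^ 'n) \<Rightarrow> (nat \<Rightarrow> real ^ 'n) \<Rightarrow> real \<Rightarrow> nat set" where
  "unsuccessful_until \<alpha> f h \<psi> \<eta>\<^sub>1 x d s \<epsilon> =
     {k. rho f h \<psi> (x k) (diag (d k)) (s k) < ereal \<eta>\<^sub>1 \<and>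
         (\<forall>i\<le>k. crit_measure \<alpha> f h \<psi> (x i) (d i) (s i) > \<epsilon>)}"

end

theory Submission
  imports Defs
begin

text \<open>
  While the criticality measure exceeds \<open>\<epsilon>\<close>, the model decrease is at least \<open>\<nu> \<epsilon>\<^sup>2\<close>, where
  \<open>\<nu> = 1 / (d_max + 1 / \<alpha>)\<close> bounds all step sizes from below. Two consequences bound the
  number of unsuccessful iterations.

  A successful iteration lowers the objective by at least \<open>\<eta>\<^sub>1 \<nu> \<epsilon>\<^sup>2\<close>, and the objective is bounded
  below; so at most \<open>O(\<epsilon>\<^sup>-\<^sup>2)\<close> successful iterations occur (\<open>decrease_count\<close>).

  The model error is at most \<open>\<kappa>_m \<Delta>\<^sup>2\<close>. Once \<open>\<Delta> \<le> \<tau> \<epsilon>\<close>, with \<open>\<tau>\<close> independent of \<open>\<epsilon>\<close>, it is at most a fraction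
  \<open>1 - \<eta>\<^sub>2\<close> of the model decrease, so the iteration is very successful and the radius grows. Hence the
  radius never falls below a fixed multiple of \<open>\<epsilon>\<close> (\<open>radius_lower_bound\<close>). Every unsuccessful
  iteration shrinks the radius at least by the factor \<open>\<gamma>\<^sub>2 < 1\<close> and every successful one enlarges it by at most
  \<open>\<gamma>\<^sub>4\<close>, so the number of unsuccessful iterations is at most a constant times the number of
  successful ones plus \<open>O(ln (1 / \<epsilon>))\<close> (\<open>shrink_count\<close>). The logarithm is absorbed by
  \<open>\<epsilon>\<^sup>-\<^sup>2\<close>.
\<close>

section \<open>Counting growth and shrinkage along real sequences\<close>

lemma decrease_count:
  fixes F :: "nat \<Rightarrow> real"
  assumes "\<And>k. k < K \<Longrightarrow> F (Suc k) \<le> F k - (if k \<in> G then c else 0)"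
  shows "c * real (card (G \<inter> {..<K})) \<le> F 0 - F K"
  using assms
proof (induction K)
  case 0
  then show ?case by simp
next
  case (Suc K)
  have "c * real (card (G \<inter> {..<K})) \<le> F 0 - F K"
    using Suc by simp
  moreover have "F (Suc K) \<le> F K - (if K \<in> G then c else 0)"
    using Suc.prems by simp
  ultimately show ?case
    by (cases "K \<in> G"; simp add: lessThan_Suc Int_insert_right distrib_left; linarith)
qed

lemma radius_upper_bound:
  fixes \<Delta> :: "nat \<Rightarrow> real"
  assumes "0 \<le> a" "0 \<le> b"
    and "\<And>k. k < K \<Longrightarrow> \<Delta> (Suc k) \<le> (if k \<in> G then a else b) * \<Delta> k"
  shows "\<Delta> K \<le> a ^ card (G \<inter> {..<K}) * b ^ card ({..<K} - G) * \<Delta> 0"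
  using assms(3)
proof (induction K)
  case 0
  then show ?case by simp
next
  case (Suc K)
  let ?B = "a ^ card (G \<inter> {..<K}) * b ^ card ({..<K} - G) * \<Delta> 0"
  have "\<Delta> (Suc K) \<le> (if K \<in> G then a else b) * \<Delta> K"
    using Suc.prems by simp
  also have "\<dots> \<le> (if K \<in> G then a else b) * ?B"
    using Suc assms(1,2) by (intro mult_left_mono) auto
  also have "\<dots> = a ^ card (G \<inter> {..<Suc K}) * b ^ card ({..<Suc K} - G) * \<Delta> 0"
    by (cases "K \<in> G") (simp_all add: lessThan_Suc Int_insert_right insert_Diff_if)
  finally show ?case .
qed

text \<open>
  A radius that only shrinks above the threshold \<open>\<delta>\<close>, and then by a factor of at least \<open>g\<close>, cannot
  jump below \<open>g * \<delta>\<close>; below that it can only have started.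
\<close>

lemma radius_lower_bound:
  fixes \<Delta> :: "nat \<Rightarrow> real"
  assumes "0 \<le> g"
    and "\<And>k. k < K \<Longrightarrow> \<Delta> k \<le> \<delta> \<Longrightarrow> \<Delta> k \<le> \<Delta> (Suc k)"
    and "\<And>k. k < K \<Longrightarrow> g * \<Delta> k \<le> \<Delta> (Suc k)"
  shows "min (\<Delta> 0) (g * \<delta>) \<le> \<Delta> K"
  using assms(2,3)
proof (induction K)
  case 0
  then show ?case by simp
next
  case (Suc K)
  have IH: "min (\<Delta> 0) (g * \<delta>) \<le> \<Delta> K"
    using Suc by simp
  show ?case
  proof (cases "\<Delta> K \<le> \<delta>")
    case True
    then show ?thesis using IH Suc.prems(1)[of K] by simp
  next
    case False
    then have "g * \<delta> \<le> g * \<Delta> K"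
      using assms(1) by (intro mult_left_mono) auto
    then show ?thesis using Suc.prems(2)[of K] by simp
  qed
qed

text \<open>
  The bounds \<open>m \<le> \<Delta> K \<le> a ^ p * b ^ q * \<Delta> 0\<close>, for \<open>p\<close> enlargements and \<open>q\<close> reductions, become
  linear in \<open>p\<close> and \<open>q\<close> on taking logarithms.
\<close>

lemma shrink_count:
  fixes \<Delta> :: "nat \<Rightarrow> real"
  assumes "0 < a" "0 < b" "0 < m" "0 < \<Delta> 0" "m \<le> \<Delta> K"
    and "\<And>k. k < K \<Longrightarrow> \<Delta> (Suc k) \<le> (if k \<in> G then a else b) * \<Delta> k"
  shows "real (card ({..<K} - G)) * ln (1 / b) \<le> ln (\<Delta> 0 / m) + real (card (G \<inter> {..<K})) * ln a"
proof -
  have "m \<le> a ^ card (G \<inter> {..<K}) * b ^ card ({..<K} - G) * \<Delta> 0"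
    using radius_upper_bound[of a b K \<Delta> G] assms by force
  then have "ln m \<le> ln (a ^ card (G \<inter> {..<K}) * b ^ card ({..<K} - G) * \<Delta> 0)"
    using assms by (intro ln_mono) auto
  also have "\<dots> = real (card (G \<inter> {..<K})) * ln a + real (card ({..<K} - G)) * ln b + ln (\<Delta> 0)"
    using assms by (simp add: ln_mult ln_realpow)
  finally show ?thesis
    using assms by (simp add: ln_div)
qed

section \<open>Values and feasibility of a single step\<close>

lemma trust_region_norm_le:
  assumes "is_norm N" "0 \<le> \<Delta>" "x + s \<in> trust_region N x \<Delta>"
  shows "N s \<le> \<Delta>"
proof -
  obtain b where b: "s = \<Delta> *\<^sub>R b" "N b \<le> 1"
    using assms(3) unfolding trust_region_def by fastforce
  then have "N s = \<Delta> * N b"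
    using assms by (simp add: is_norm_def)
  then show ?thesis
    using b assms(2) mult_left_le by metis
qed

text \<open>
  The null step is feasible with a value below infinity, so a minimiser cannot pay the infinite
  penalty of infeasibility.
\<close>

lemma tr_step_feasible:
  assumes "is_tr_step l u N x \<Delta> m s" "x \<in> box_set l u" "is_norm N" "0 \<le> \<Delta>" "m 0 \<noteq> \<infinity>"
  shows "x + s \<in> box_set l u" "N s \<le> \<Delta>"
proof -
  let ?A = "box_set l u \<inter> trust_region N x \<Delta>"
  have "N 0 = 0"
    using assms(3) by (simp add: is_norm_def)
  then have "x \<in> trust_region N x \<Delta>"
    by (auto simp: trust_region_def intro!: image_eqI[of _ _ 0])
  then have "m 0 + chi ?A (x + 0) < \<infinity>"
    using assms(2,5) by (simp add: chi_def less_top)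
  then have "x + s \<in> ?A"
    using assms(1) by (auto simp: is_tr_step_def is_arg_min_def chi_def split: if_splits)
  then show "x + s \<in> box_set l u" "N s \<le> \<Delta>"
    using trust_region_norm_le assms(3,4) by auto
qed

lemma ereal_diff_bounded_imp_finite:
  fixes a b :: ereal
  assumes "\<bar>a - b\<bar> \<le> ereal e"
  shows "\<bar>a\<bar> \<noteq> \<infinity>" "\<bar>b\<bar> \<noteq> \<infinity>"
  using assms by (cases a; cases b; simp)+

lemma m_D_zero:
  assumes "is_model h \<psi>" "\<bar>h x\<bar> \<noteq> \<infinity>"
  shows "m_D f \<psi> x D 0 = objective f h x"
  using assms by (simp add: is_model_def m_D_def phi_cp_def objective_def)

text \<open>
  A bounded model error forces the objective and the model at the trial point to be finite, so that
  the ratio \<open>rho\<close> is one of real numbers.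
\<close>

lemma step_values:
  assumes "is_model h \<psi>" "\<bar>h x\<bar> \<noteq> \<infinity>" "0 < xi f h \<psi> x D s"
    and "\<bar>objective f h (x + s) - m_D f \<psi> x D s\<bar> \<le> ereal e"
  shows "\<exists>F P q. objective f h x = ereal F \<and> objective f h (x + s) = ereal P \<and>
    xi f h \<psi> x D s = ereal q \<and> 0 < q \<and> rho f h \<psi> x D s = ereal ((F - P) / q) \<and>
    \<bar>P - (F - q)\<bar> \<le> e"
proof -
  obtain P where P: "objective f h (x + s) = ereal P"
    using ereal_diff_bounded_imp_finite[OF assms(4)] by auto
  obtain M where M: "m_D f \<psi> x D s = ereal M"
    using ereal_diff_bounded_imp_finite[OF assms(4)] by auto
  obtain F where F: "objective f h x = ereal F"
    using assms(2) by (cases "h x") (auto simp: objective_def)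
  show ?thesis
    using assms(3,4) m_D_zero[OF assms(1,2), of f D]
    by (intro exI[of _ F] exI[of _ P] exI[of _ "F - M"])
       (auto simp: P M F xi_def rho_def)
qed

lemma step_size_bounds:
  assumes "0 < \<alpha>" "infnorm d \<le> d_max"
  shows "0 < step_size \<alpha> d" "1 / (d_max + inverse \<alpha>) \<le> step_size \<alpha> d"
proof -
  have "0 < infnorm d + inverse \<alpha>"
    using assms(1) infnorm_pos_le[of d] by (simp add: add_nonneg_pos)
  then show "0 < step_size \<alpha> d" "1 / (d_max + inverse \<alpha>) \<le> step_size \<alpha> d"
    using assms(2) by (auto simp: step_size_def intro!: divide_left_mono)
qed

lemma crit_measure_gt_imp_xi_gt:
  assumes "0 < \<alpha>" "infnorm d \<le> d_max" "0 < \<epsilon>" "0 < q"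
    and "xi f h \<psi> x (diag d) s = ereal q" "\<epsilon> < crit_measure \<alpha> f h \<psi> x d s"
  shows "1 / (d_max + inverse \<alpha>) * \<epsilon>\<^sup>2 < q"
proof -
  let ?\<nu> = "step_size \<alpha> d"
  note \<nu> = step_size_bounds[OF assms(1,2)]
  have "crit_measure \<alpha> f h \<psi> x d s = sqrt (q / ?\<nu>)"
    using \<nu>(1) assms(4,5)
    by (simp add: crit_measure_def powr_minus powr_half_sqrt real_sqrt_divide field_simps)
  then have "\<epsilon>\<^sup>2 < q / ?\<nu>"
    using assms(3,6) real_less_rsqrt by (metis less_eq_real_def not_less real_le_lsqrt)
  then have "?\<nu> * \<epsilon>\<^sup>2 < q"
    using \<nu>(1) by (simp add: field_simps)
  moreover have "1 / (d_max + inverse \<alpha>) * \<epsilon>\<^sup>2 \<le> ?\<nu> * \<epsilon>\<^sup>2"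
    using \<nu>(2) by (intro mult_right_mono) auto
  ultimately show ?thesis by simp
qed

section \<open>The trust-region mechanism on real sequences\<close>

text \<open>
  Only the real values of a run matter: \<open>F k\<close> is the objective at the iterate, \<open>P k\<close> at the trial
  point and \<open>q k\<close> is the model decrease. All model decreases before \<open>K\<close> exceed \<open>\<nu> * \<epsilon>\<^sup>2\<close>, and
  \<open>\<tau> * \<epsilon>\<close> is the radius at which \<open>\<kappa> * \<Delta>\<^sup>2\<close> equals \<open>(1 - \<eta>\<^sub>2) * (\<nu> * \<epsilon>\<^sup>2)\<close>.
\<close>

lemma unsuccessful_count:
  fixes F P q \<Delta> :: "nat \<Rightarrow> real" and \<epsilon> \<nu> \<kappa> \<eta>\<^sub>1 \<eta>\<^sub>2 \<gamma>\<^sub>1 \<gamma>\<^sub>2 \<gamma>\<^sub>3 \<gamma>\<^sub>4 low :: real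
  defines "\<rho> \<equiv> \<lambda>k. (F k - P k) / q k"
  defines "\<tau> \<equiv> sqrt ((1 - \<eta>\<^sub>2) * \<nu> / \<kappa>)"
  assumes pos: "0 < \<nu>" "0 < \<kappa>" "0 < \<epsilon>" "\<epsilon> < 1"
    and eta: "0 < \<eta>\<^sub>1" "\<eta>\<^sub>1 \<le> \<eta>\<^sub>2" "\<eta>\<^sub>2 < 1"
    and gamma: "0 < \<gamma>\<^sub>1" "\<gamma>\<^sub>1 \<le> \<gamma>\<^sub>2" "\<gamma>\<^sub>2 < 1" "1 < \<gamma>\<^sub>3" "\<gamma>\<^sub>3 \<le> \<gamma>\<^sub>4"
    and radius_pos: "\<And>k. 0 < \<Delta> k"
    and decrease: "\<And>k. k < K \<Longrightarrow> \<nu> * \<epsilon>\<^sup>2 < q k"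
    and error: "\<And>k. k < K \<Longrightarrow> \<bar>P k - (F k - q k)\<bar> \<le> \<kappa> * (\<Delta> k)\<^sup>2"
    and next_value: "\<And>k. k < K \<Longrightarrow> F (Suc k) = (if \<eta>\<^sub>1 \<le> \<rho> k then P k else F k)"
    and very_successful: "\<And>k. \<eta>\<^sub>2 \<le> \<rho> k \<Longrightarrow> \<Delta> (Suc k) \<in> {\<gamma>\<^sub>3 * \<Delta> k .. \<gamma>\<^sub>4 * \<Delta> k}"
    and successful: "\<And>k. \<eta>\<^sub>1 \<le> \<rho> k \<Longrightarrow> \<rho> k < \<eta>\<^sub>2 \<Longrightarrow> \<Delta> (Suc k) \<in> {\<gamma>\<^sub>2 * \<Delta> k .. \<Delta> k}"
    and unsuccessful: "\<And>k. \<rho> k < \<eta>\<^sub>1 \<Longrightarrow> \<Delta> (Suc k) \<in> {\<gamma>\<^sub>1 * \<Delta> k .. \<gamma>\<^sub>2 * \<Delta> k}"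
    and low: "low \<le> F K"
    and small: "\<gamma>\<^sub>1 * (\<tau> * \<epsilon>) \<le> \<Delta> 0"
  shows "real (card {k. k < K \<and> \<rho> k < \<eta>\<^sub>1})
    \<le> (\<Delta> 0 / (\<gamma>\<^sub>1 * \<tau>) + (F 0 - low) / (\<eta>\<^sub>1 * \<nu>) * ln \<gamma>\<^sub>4) / ln (1 / \<gamma>\<^sub>2) / \<epsilon>\<^sup>2"
proof -
  define G where "G = {k. \<eta>\<^sub>1 \<le> \<rho> k}"
  let ?p = "real (card (G \<inter> {..<K}))"
  have q_pos: "0 < q k" if "k < K" for k
    using decrease[OF that] pos by (smt (verit) mult_pos_pos zero_less_power)
  have \<tau>_pos: "0 < \<tau>"
    using pos eta by (simp add: \<tau>_def)

  have "F (Suc k) \<le> F k - (if k \<in> G then \<eta>\<^sub>1 * (\<nu> * \<epsilon>\<^sup>2) else 0)" if k: "k < K" for k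
  proof (cases "k \<in> G")
    case True
    then have "\<eta>\<^sub>1 * q k \<le> F k - P k"
      using q_pos[OF k] by (simp add: G_def \<rho>_def pos_le_divide_eq)
    moreover have "\<eta>\<^sub>1 * (\<nu> * \<epsilon>\<^sup>2) \<le> \<eta>\<^sub>1 * q k"
      using decrease[OF k] eta by (intro mult_left_mono) auto
    ultimately show ?thesis
      using True next_value[OF k] by (simp add: G_def)
  qed (use next_value[OF k] in \<open>simp add: G_def\<close>)
  then have "\<eta>\<^sub>1 * (\<nu> * \<epsilon>\<^sup>2) * ?p \<le> F 0 - low"
    using decrease_count[of K F G "\<eta>\<^sub>1 * (\<nu> * \<epsilon>\<^sup>2)"] low by auto
  then have p_le: "?p \<le> (F 0 - low) / (\<eta>\<^sub>1 * \<nu>) / \<epsilon>\<^sup>2"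
    using pos eta by (simp add: field_simps)

  have grow: "\<Delta> k \<le> \<Delta> (Suc k)" if k: "k < K" and le: "\<Delta> k \<le> \<tau> * \<epsilon>" for k
  proof -
    have "\<kappa> * (\<Delta> k)\<^sup>2 \<le> \<kappa> * (\<tau> * \<epsilon>)\<^sup>2"
      using le radius_pos[of k] pos by (intro mult_left_mono power_mono) auto
    also have "\<dots> = (1 - \<eta>\<^sub>2) * (\<nu> * \<epsilon>\<^sup>2)"
      using pos eta by (simp add: \<tau>_def power_mult_distrib)
    also have "\<dots> \<le> (1 - \<eta>\<^sub>2) * q k"
      using decrease[OF k] eta by (intro mult_left_mono) auto
    finally have "\<eta>\<^sub>2 * q k \<le> F k - P k"
      using error[OF k] by (simp add: abs_le_iff algebra_simps)
    then have "\<eta>\<^sub>2 \<le> \<rho> k"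
      using q_pos[OF k] by (simp add: \<rho>_def pos_le_divide_eq)
    then have "\<gamma>\<^sub>3 * \<Delta> k \<le> \<Delta> (Suc k)"
      using very_successful by auto
    moreover have "1 * \<Delta> k \<le> \<gamma>\<^sub>3 * \<Delta> k"
      using gamma radius_pos[of k] by (intro mult_right_mono) auto
    ultimately show ?thesis by simp
  qed
  have rate: "\<gamma>\<^sub>1 * \<Delta> k \<le> \<Delta> (Suc k)" "\<Delta> (Suc k) \<le> (if k \<in> G then \<gamma>\<^sub>4 else \<gamma>\<^sub>2) * \<Delta> k" for k
  proof -
    have "\<gamma>\<^sub>1 * \<Delta> k \<le> \<gamma>\<^sub>2 * \<Delta> k" "\<gamma>\<^sub>2 * \<Delta> k \<le> \<gamma>\<^sub>3 * \<Delta> k" "1 * \<Delta> k \<le> \<gamma>\<^sub>4 * \<Delta> k"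
      using gamma radius_pos[of k] by (intro mult_right_mono; simp)+
    then show "\<gamma>\<^sub>1 * \<Delta> k \<le> \<Delta> (Suc k)" "\<Delta> (Suc k) \<le> (if k \<in> G then \<gamma>\<^sub>4 else \<gamma>\<^sub>2) * \<Delta> k"
      using very_successful[of k] successful[of k] unsuccessful[of k] eta
      by (fastforce simp: G_def not_le)+
  qed
  have "\<gamma>\<^sub>1 * (\<tau> * \<epsilon>) \<le> \<Delta> K"
    using radius_lower_bound[of \<gamma>\<^sub>1 K \<Delta> "\<tau> * \<epsilon>"] grow rate(1) gamma small by simp
  then have "real (card ({..<K} - G)) * ln (1 / \<gamma>\<^sub>2) \<le> ln (\<Delta> 0 / (\<gamma>\<^sub>1 * (\<tau> * \<epsilon>))) + ?p * ln \<gamma>\<^sub>4"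
    using gamma pos \<tau>_pos radius_pos rate(2) by (intro shrink_count) auto
  also have "\<dots> \<le> \<Delta> 0 / (\<gamma>\<^sub>1 * \<tau>) / \<epsilon>\<^sup>2 + (F 0 - low) / (\<eta>\<^sub>1 * \<nu>) / \<epsilon>\<^sup>2 * ln \<gamma>\<^sub>4"
  proof (intro add_mono mult_right_mono p_le)
    have "\<epsilon>\<^sup>2 \<le> \<epsilon>"
      using pos by (simp add: power2_eq_square)
    then have "\<Delta> 0 / (\<gamma>\<^sub>1 * \<tau>) / \<epsilon> \<le> \<Delta> 0 / (\<gamma>\<^sub>1 * \<tau>) / \<epsilon>\<^sup>2"
      using pos gamma \<tau>_pos radius_pos[of 0] by (intro divide_left_mono) auto
    moreover have "ln (\<Delta> 0 / (\<gamma>\<^sub>1 * (\<tau> * \<epsilon>))) \<le> \<Delta> 0 / (\<gamma>\<^sub>1 * (\<tau> * \<epsilon>))"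
      using pos gamma \<tau>_pos radius_pos[of 0] by (intro ln_bound) auto
    ultimately show "ln (\<Delta> 0 / (\<gamma>\<^sub>1 * (\<tau> * \<epsilon>))) \<le> \<Delta> 0 / (\<gamma>\<^sub>1 * \<tau>) / \<epsilon>\<^sup>2"
      by (simp add: mult.assoc)
  qed (use gamma in simp)
  also have "\<dots> = (\<Delta> 0 / (\<gamma>\<^sub>1 * \<tau>) + (F 0 - low) / (\<eta>\<^sub>1 * \<nu>) * ln \<gamma>\<^sub>4) / \<epsilon>\<^sup>2"
    by (simp add: add_divide_distrib)
  finally have "real (card ({..<K} - G)) * ln (1 / \<gamma>\<^sub>2)
      \<le> (\<Delta> 0 / (\<gamma>\<^sub>1 * \<tau>) + (F 0 - low) / (\<eta>\<^sub>1 * \<nu>) * ln \<gamma>\<^sub>4) / \<epsilon>\<^sup>2" .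
  moreover have "0 < ln (1 / \<gamma>\<^sub>2)"
    using gamma by (intro ln_gt_zero) auto
  moreover have "{k. k < K \<and> \<rho> k < \<eta>\<^sub>1} = {..<K} - G"
    by (auto simp: G_def)
  ultimately have "real (card {k. k < K \<and> \<rho> k < \<eta>\<^sub>1})
      \<le> (\<Delta> 0 / (\<gamma>\<^sub>1 * \<tau>) + (F 0 - low) / (\<eta>\<^sub>1 * \<nu>) * ln \<gamma>\<^sub>4) / \<epsilon>\<^sup>2 / ln (1 / \<gamma>\<^sub>2)"
    by (simp only: pos_le_divide_eq)
  then show ?thesis
    by (simp only: divide_divide_eq_left mult.commute)
qed

section \<open>The number of unsuccessful iterations\<close>

text \<open>
  Feasibility and finiteness are propagated together: a finite objective at a feasible iterate makes
  the null step admissible, hence the computed step feasible, and the bounded model error makes the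
  objective at the trial point finite again.
\<close>

lemma run_invariant:
  assumes run: "iTRDH_run l u N f h \<psi> \<eta>\<^sub>1 \<eta>\<^sub>2 \<gamma>\<^sub>1 \<gamma>\<^sub>2 \<gamma>\<^sub>3 \<gamma>\<^sub>4 x s d \<Delta>"
    and "is_model h \<psi>" "is_norm N"
    and gamma: "0 < \<gamma>\<^sub>1" "\<gamma>\<^sub>1 \<le> \<gamma>\<^sub>2" "\<gamma>\<^sub>2 \<le> \<gamma>\<^sub>3"
    and error: "\<And>k. \<bar>objective f h (x k + s k) - m_D f \<psi> (x k) (diag (d k)) (s k)\<bar> \<le> ereal (e k)"
  shows "x k \<in> box_set l u \<and> \<bar>h (x k)\<bar> \<noteq> \<infinity> \<and> 0 < \<Delta> k \<and> N (s k) \<le> \<Delta> k"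
proof -
  have step: "x k + s k \<in> box_set l u" "N (s k) \<le> \<Delta> k"
    if "x k \<in> box_set l u" "\<bar>h (x k)\<bar> \<noteq> \<infinity>" "0 < \<Delta> k" for k
  proof -
    have "m_D f \<psi> (x k) (diag (d k)) 0 \<noteq> \<infinity>"
      using that m_D_zero[OF assms(2), of "x k" f] by (auto simp: objective_def)
    moreover have "is_tr_step l u N (x k) (\<Delta> k) (m_D f \<psi> (x k) (diag (d k))) (s k)"
      using run by (simp add: iTRDH_run_def)
    ultimately show "x k + s k \<in> box_set l u" "N (s k) \<le> \<Delta> k"
      using tr_step_feasible assms(3) that by (metis less_imp_le)+
  qed
  have "x k \<in> box_set l u \<and> \<bar>h (x k)\<bar> \<noteq> \<infinity> \<and> 0 < \<Delta> k"
  proof (induction k)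
    case 0
    then show ?case using run by (simp add: iTRDH_run_def)
  next
    case (Suc k)
    let ?r = "rho f h \<psi> (x k) (diag (d k)) (s k)"
    have "\<bar>h (x k + s k)\<bar> \<noteq> \<infinity>"
      using ereal_diff_bounded_imp_finite(1)[OF error[of k]]
      by (cases "h (x k + s k)") (auto simp: objective_def)
    moreover have "x (Suc k) = (if ereal \<eta>\<^sub>1 \<le> ?r then x k + s k else x k)"
      using run by (simp add: iTRDH_run_def Let_def)
    moreover have "\<gamma>\<^sub>1 * \<Delta> k \<le> \<Delta> (Suc k) \<or> \<gamma>\<^sub>2 * \<Delta> k \<le> \<Delta> (Suc k) \<or> \<gamma>\<^sub>3 * \<Delta> k \<le> \<Delta> (Suc k)"
      using run unfolding iTRDH_run_def Let_def by (meson atLeastAtMost_iff not_le)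
    moreover have "0 < \<gamma>\<^sub>1 * \<Delta> k" "0 < \<gamma>\<^sub>2 * \<Delta> k" "0 < \<gamma>\<^sub>3 * \<Delta> k"
      using Suc gamma by auto
    ultimately show ?case
      using Suc step[of k] by auto
  qed
  then show ?thesis using step(2)[of k] by simp
qed

theorem lemma3:
  fixes f :: "real ^ 'n \<Rightarrow> real"
    and h :: "real ^ 'n \<Rightarrow> ereal"
    and \<psi> :: "real ^ 'n \<Rightarrow> real ^ 'n \<Rightarrow> ereal"
    and l u :: "ereal ^ 'n"
    and N :: "real ^ 'n \<Rightarrow> real"
    and \<eta>\<^sub>1 \<eta>\<^sub>2 \<gamma>\<^sub>1 \<gamma>\<^sub>2 \<gamma>\<^sub>3 \<gamma>\<^sub>4 \<alpha> d_max \<kappa>_m \<kappa>_mdc low :: real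
    and x s s1 d :: "nat \<Rightarrow> real ^ 'n"
    and \<Delta> :: "nat \<Rightarrow> real"
  assumes bounds: "\<forall>i. l $ i \<noteq> \<infinity> \<and> u $ i \<noteq> -\<infinity> \<and> l $ i \<le> u $ i"
    and f_C1: "\<exists>S. open S \<and> box_set l u \<subseteq> S \<and> C1_on f S"
    and h_reg: "proper_fun h" "lsc_fun h"
    and psi_model: "is_model h \<psi>"
    and tr_norm: "is_norm N"
    and eta: "0 < \<eta>\<^sub>1" "\<eta>\<^sub>1 \<le> \<eta>\<^sub>2" "\<eta>\<^sub>2 < 1"
    and gamma: "0 < 1 / \<gamma>\<^sub>3" "1 / \<gamma>\<^sub>3 \<le> \<gamma>\<^sub>1" "\<gamma>\<^sub>1 \<le> \<gamma>\<^sub>2" "\<gamma>\<^sub>2 < 1" "1 < \<gamma>\<^sub>3" "\<gamma>\<^sub>3 \<le> \<gamma>\<^sub>4"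
    and alpha: "0 < \<alpha>"
    and run: "iTRDH_run l u N f h \<psi> \<eta>\<^sub>1 \<eta>\<^sub>2 \<gamma>\<^sub>1 \<gamma>\<^sub>2 \<gamma>\<^sub>3 \<gamma>\<^sub>4 x s d \<Delta>"
    and xi_pos: "\<forall>k. 0 < xi f h \<psi> (x k) (diag (d k)) (s k)"
    and cauchy_step:
      "\<forall>k. is_tr_step l u N (x k) (\<Delta> k) (m_nu f \<psi> (x k) (step_size \<alpha> (d k))) (s1 k)"
    and d_bounded: "0 < d_max" "\<forall>k. infnorm (d k) \<le> d_max"
    and kappa_m: "0 < \<kappa>_m"
      "\<forall>k. \<bar>objective f h (x k + s k) - m_D f \<psi> (x k) (diag (d k)) (s k)\<bar>
             \<le> ereal (\<kappa>_m * (N (s k))\<^sup>2)"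
    and kappa_mdc: "0 < \<kappa>_mdc" "\<kappa>_mdc < 1"
      "\<forall>k. xi f h \<psi> (x k) (diag (d k)) (s k) \<ge> ereal \<kappa>_mdc * xi_cp f h \<psi> (x k) (s1 k)"
    and inf_succ: "infinite {k. rho f h \<psi> (x k) (diag (d k)) (s k) \<ge> ereal \<eta>\<^sub>1}"
    and bounded_below: "\<forall>k. objective f h (x k) \<ge> ereal low"
  shows "\<exists>C>0. \<forall>\<^sub>F \<epsilon> in at_right 0.
           finite (unsuccessful_until \<alpha> f h \<psi> \<eta>\<^sub>1 x d s \<epsilon>) \<and>
           real (card (unsuccessful_until \<alpha> f h \<psi> \<eta>\<^sub>1 x d s \<epsilon>)) \<le> C * \<epsilon> powi (-2)"
proof -
  have gamma1_pos: "0 < \<gamma>\<^sub>1"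
    using gamma by linarith
  define \<nu> where "\<nu> = 1 / (d_max + inverse \<alpha>)"
  have \<nu>_pos: "0 < \<nu>"
    using alpha d_bounded(1) by (simp add: \<nu>_def add_pos_pos)
  let ?\<rho> = "\<lambda>k. rho f h \<psi> (x k) (diag (d k)) (s k)"
  have inv: "x k \<in> box_set l u \<and> \<bar>h (x k)\<bar> \<noteq> \<infinity> \<and> 0 < \<Delta> k \<and> N (s k) \<le> \<Delta> k" for k
    using run_invariant[OF run psi_model tr_norm gamma1_pos gamma(3), where e = "\<lambda>k. \<kappa>_m * (N (s k))\<^sup>2"]
      gamma kappa_m(2) by auto
  have "\<forall>k. \<exists>F P q. objective f h (x k) = ereal F \<and> objective f h (x k + s k) = ereal P \<and>
      xi f h \<psi> (x k) (diag (d k)) (s k) = ereal q \<and> 0 < q \<and> ?\<rho> k = ereal ((F - P) / q) \<and>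
      \<bar>P - (F - q)\<bar> \<le> \<kappa>_m * (N (s k))\<^sup>2"
    using inv by (intro allI step_values[OF psi_model _ xi_pos[rule_format] kappa_m(2)[rule_format]]) simp
  then obtain F P q where vals: "\<And>k. objective f h (x k) = ereal (F k)"
      "\<And>k. objective f h (x k + s k) = ereal (P k)"
      "\<And>k. xi f h \<psi> (x k) (diag (d k)) (s k) = ereal (q k)" "\<And>k. 0 < q k"
      "\<And>k. ?\<rho> k = ereal ((F k - P k) / q k)"
      "\<And>k. \<bar>P k - (F k - q k)\<bar> \<le> \<kappa>_m * (N (s k))\<^sup>2"
    by metis
  have norm_nonneg: "0 \<le> N v" for v
  proof -
    have "N 0 = 0" "N (- v) = N v" "N (v + - v) \<le> N v + N (- v)"
      using tr_norm unfolding is_norm_def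
      by (blast, metis abs_minus_cancel abs_one mult_1 scaleR_minus1_left, blast)
    then show ?thesis by simp
  qed
  have error: "\<bar>P k - (F k - q k)\<bar> \<le> \<kappa>_m * (\<Delta> k)\<^sup>2" for k
  proof -
    have "\<kappa>_m * (N (s k))\<^sup>2 \<le> \<kappa>_m * (\<Delta> k)\<^sup>2"
      using inv[of k] norm_nonneg kappa_m(1) by (intro mult_left_mono power_mono) auto
    then show ?thesis using vals(6)[of k] by linarith
  qed
  have next_value: "F (Suc k) = (if \<eta>\<^sub>1 \<le> (F k - P k) / q k then P k else F k)" for k
  proof -
    have "x (Suc k) = (if ereal \<eta>\<^sub>1 \<le> ?\<rho> k then x k + s k else x k)"
      using run by (simp add: iTRDH_run_def Let_def)
    then show ?thesis
      using vals(1)[of "Suc k"] vals(1,2,5)[of k] by (simp split: if_splits)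
  qed
  have update:
    "\<eta>\<^sub>2 \<le> (F k - P k) / q k \<Longrightarrow> \<Delta> (Suc k) \<in> {\<gamma>\<^sub>3 * \<Delta> k .. \<gamma>\<^sub>4 * \<Delta> k}"
    "\<eta>\<^sub>1 \<le> (F k - P k) / q k \<Longrightarrow> (F k - P k) / q k < \<eta>\<^sub>2 \<Longrightarrow> \<Delta> (Suc k) \<in> {\<gamma>\<^sub>2 * \<Delta> k .. \<Delta> k}"
    "(F k - P k) / q k < \<eta>\<^sub>1 \<Longrightarrow> \<Delta> (Suc k) \<in> {\<gamma>\<^sub>1 * \<Delta> k .. \<gamma>\<^sub>2 * \<Delta> k}" for k
    using run unfolding iTRDH_run_def Let_def vals(5) ereal_less_eq less_ereal.simps by blast+
  have low_le: "low \<le> F k" for k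
    using bounded_below vals(1) by simp

  define \<tau> where "\<tau> = sqrt ((1 - \<eta>\<^sub>2) * \<nu> / \<kappa>_m)"
  have \<tau>_pos: "0 < \<tau>"
    using \<nu>_pos kappa_m(1) eta by (simp add: \<tau>_def)
  define C where "C = (\<Delta> 0 / (\<gamma>\<^sub>1 * \<tau>) + (F 0 - low) / (\<eta>\<^sub>1 * \<nu>) * ln \<gamma>\<^sub>4) / ln (1 / \<gamma>\<^sub>2)"
  have C_pos: "0 < C"
  proof -
    have "0 < \<Delta> 0 / (\<gamma>\<^sub>1 * \<tau>)"
      using inv[of 0] gamma1_pos \<tau>_pos by simp
    moreover have "0 \<le> (F 0 - low) / (\<eta>\<^sub>1 * \<nu>) * ln \<gamma>\<^sub>4"
      using low_le[of 0] eta \<nu>_pos gamma by simp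
    moreover have "0 < ln (1 / \<gamma>\<^sub>2)"
      using gamma gamma1_pos by (intro ln_gt_zero) auto
    ultimately show ?thesis by (simp add: C_def)
  qed

  have main: "finite (unsuccessful_until \<alpha> f h \<psi> \<eta>\<^sub>1 x d s \<epsilon>) \<and>
      real (card (unsuccessful_until \<alpha> f h \<psi> \<eta>\<^sub>1 x d s \<epsilon>)) \<le> C * \<epsilon> powi (-2)"
    if \<epsilon>: "0 < \<epsilon>" "\<epsilon> < 1" "\<epsilon> \<le> \<Delta> 0 / (\<gamma>\<^sub>1 * \<tau>)" for \<epsilon>
  proof -
    let ?U = "unsuccessful_until \<alpha> f h \<psi> \<eta>\<^sub>1 x d s \<epsilon>"
    have small: "\<gamma>\<^sub>1 * (\<tau> * \<epsilon>) \<le> \<Delta> 0"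
      using \<epsilon>(3) gamma1_pos \<tau>_pos by (simp add: field_simps)
    \<comment> \<open>The set is not known to be finite, so the count is bounded on each finite part, whose last
      element delimits a range of iterations with criticality measure above \<open>\<epsilon>\<close>.\<close>
    have "card T \<le> nat \<lfloor>C / \<epsilon>\<^sup>2\<rfloor>" if T: "T \<subseteq> ?U" "finite T" for T
    proof (cases "T = {}")
      case False
      define K where "K = Suc (Max T)"
      have "Max T \<in> ?U"
        using T False Max_in by blast
      then have "\<epsilon> < crit_measure \<alpha> f h \<psi> (x k) (d k) (s k)" if "k < K" for k
        using that by (simp add: unsuccessful_until_def K_def)
      then have decrease: "\<nu> * \<epsilon>\<^sup>2 < q k" if "k < K" for k
        using crit_measure_gt_imp_xi_gt[OF alpha _ \<epsilon>(1) vals(4,3)] d_bounded(2) that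
        unfolding \<nu>_def by blast
      have "T \<subseteq> {k. k < K \<and> (F k - P k) / q k < \<eta>\<^sub>1}"
        using T by (auto simp: unsuccessful_until_def vals(5) K_def less_Suc_eq_le)
      then have "card T \<le> card {k. k < K \<and> (F k - P k) / q k < \<eta>\<^sub>1}"
        by (intro card_mono) auto
      also have "real \<dots> \<le> C / \<epsilon>\<^sup>2"
        unfolding C_def \<tau>_def
        by (rule unsuccessful_count[OF \<nu>_pos kappa_m(1) \<epsilon>(1,2) eta gamma1_pos gamma(3-6)])
           (use inv decrease error next_value update low_le small in \<open>auto simp: \<tau>_def\<close>)
      finally show ?thesis by (simp add: le_nat_floor)
    qed simp
    then have U: "finite ?U \<and> card ?U \<le> nat \<lfloor>C / \<epsilon>\<^sup>2\<rfloor>"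
      by (rule finite_if_finite_subsets_card_bdd)
    then have "real (card ?U) \<le> C / \<epsilon>\<^sup>2"
      using C_pos of_nat_floor[of "C / \<epsilon>\<^sup>2"] by (simp add: le_nat_iff le_floor_iff)
    also have "\<dots> = C * \<epsilon> powi (-2)"
      by (simp add: power_int_minus divide_inverse)
    finally show ?thesis using U by blast
  qed
  have "0 < min 1 (\<Delta> 0 / (\<gamma>\<^sub>1 * \<tau>))"
    using inv[of 0] gamma1_pos \<tau>_pos by simp
  then have "\<forall>\<^sub>F \<epsilon> in at_right 0. \<epsilon> \<in> {0<..<min 1 (\<Delta> 0 / (\<gamma>\<^sub>1 * \<tau>))}"
    by (rule eventually_at_right_real)
  then have "\<forall>\<^sub>F \<epsilon> in at_right 0. finite (unsuccessful_until \<alpha> f h \<psi> \<eta>\<^sub>1 x d s \<epsilon>) \<and>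
      real (card (unsuccessful_until \<alpha> f h \<psi> \<eta>\<^sub>1 x d s \<epsilon>)) \<le> C * \<epsilon> powi (-2)"
    by (rule eventually_mono) (use main in auto)
  then show ?thesis
    using C_pos by blast
qed

end
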